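(* Let $\mathcal{S}$ be any one of the twelve step sets (Models 5 to 16) of the form $\mathcal{S}=T$ or $\mathcal{S}=T\cup\{(1,0),(-1,0)\}$, where $T$ is one of $\{(1,1),(-1,1),(0,-1)\}$ (Models 5, 6); $\{(0,1),(1,1),(-1,1),(0,-1)\}$ (Models 7, 8); $\{(0,1),(1,1),(-1,1),(1,-1),(-1,-1)\}$ (Models 9, 10); $\{(0,1),(0,-1),(1,-1),(-1,-1)\}$ (Models 11, 12); $\{(1,1),(-1,1),(0,-1),(1,-1),(-1,-1)\}$ (Models 13, 14); $\{(0,1),(1,-1),(-1,-1)\}$ (Models 15, 16). Let $G(t;a,b)$ be the length generating function of quarter plane walks with step set $\mathcal{S}$ starting and ending at the origin, with weight $a$ per visit to the line $y=0$ and weight $b$ per visit to the line $x=0$. Then $G(t;a,1)$ is D-finite.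
   Context: Given a step set $\mathcal{S}\subseteq\{-1,0,1\}^2\setminus\{(0,0)\}$, a quarter plane walk of length $n$ is a walk in $\mathbb{Z}_{\ge 0}^2$ starting at $(0,0)$ and taking $n$ steps from $\mathcal{S}$, all of whose vertices lie in $\mathbb{Z}_{\ge0}^2$. Let $q_{n,k,\ell,h,v}$ be the number of such walks of length $n$ ending at $(k,\ell)$ which visit the horizontal boundary $y=0$ exactly $h$ times and the vertical boundary $x=0$ exactly $v$ times. The origin belongs to both boundaries, so a visit to the origin contributes $1$ to both $h$ and $v$ (weight $ab$). The starting vertex is not counted as a visit, so the empty walk has weight $1$. Define $$G(t;a,b)=\sum_{n\ge0}t^n\sum_{h,v\ge0}q_{n,0,0,h,v}\,a^hb^v\in\mathbb{Z}[a,b][[t]].$$ D-finite means: a formal series in $t$ which satisfies a non-trivial linear differential equation with respect to $t$ with polynomial coefficients in $t$. Here $a$ is regarded as an indeterminate, i.e. the base field of coefficients is $\mathbb{Q}(a)$ (so the polynomial coefficients lie in $\mathbb{Q}(a)[t]$). *)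

theory Defs
  imports
    "HOL-Computational_Algebra.Computational_Algebra"
    "HOL-Library.Product_Plus"
begin

text \<open>
  A walk of length \<open>n\<close> is represented by its list of \<open>n + 1\<close> vertices.  As the vertices
  determine the steps, this is the same as counting step sequences.
\<close>

definition quarter_walks :: "(int \<times> int) set \<Rightarrow> nat \<Rightarrow> (int \<times> int) list set" where
  "quarter_walks S n =
     {w. length w = Suc n \<and> w ! 0 = (0, 0) \<and>
         (\<forall>i<n. w ! Suc i - w ! i \<in> S) \<and>
         (\<forall>p\<in>set w. 0 \<le> fst p \<and> 0 \<le> snd p)}"

text \<open>The starting vertex (index \<open>0\<close>) is not counted as a visit.\<close>

definition hvisits :: "(int \<times> int) list \<Rightarrow> nat" where
  "hvisits w = card {i. 1 \<le> i \<and> i < length w \<and> snd (w ! i) = 0}"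

definition vvisits :: "(int \<times> int) list \<Rightarrow> nat" where
  "vvisits w = card {i. 1 \<le> i \<and> i < length w \<and> fst (w ! i) = 0}"

definition num_walks :: "(int \<times> int) set \<Rightarrow> nat \<Rightarrow> int \<Rightarrow> int \<Rightarrow> nat \<Rightarrow> nat \<Rightarrow> nat" where
  "num_walks S n k l h v =
     card {w \<in> quarter_walks S n. w ! n = (k, l) \<and> hvisits w = h \<and> vvisits w = v}"

text \<open>
  \<open>G(t; a, b)\<close> for weights \<open>a\<close>, \<open>b\<close> in an arbitrary commutative ring.  The inner sum over
  all \<open>h, v \<ge> 0\<close> may be cut off at \<open>n\<close>, see \<open>num_walks_eq_0\<close> below.
\<close>

definition walk_gf :: "(int \<times> int) set \<Rightarrow> 'a::comm_ring_1 \<Rightarrow> 'a \<Rightarrow> 'a fps" where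
  "walk_gf S a b =
     Abs_fps (\<lambda>n. \<Sum>h\<le>n. \<Sum>v\<le>n. of_nat (num_walks S n 0 0 h v) * a ^ h * b ^ v)"

definition D_finite :: "'a::field_char_0 fps \<Rightarrow> bool" where
  "D_finite f \<longleftrightarrow>
     (\<exists>(r::nat) p :: nat \<Rightarrow> 'a poly.
        (\<exists>i\<le>r. p i \<noteq> 0) \<and> (\<Sum>i\<le>r. fps_of_poly (p i) * fps_nth_deriv i f) = 0)"

text \<open>The indeterminate \<open>a\<close> of \<open>\<rat>(a)\<close>, the fraction field of \<open>\<rat>[a]\<close>.\<close>

definition indet_a :: "rat poly fract" where
  "indet_a = Fract [:0, 1:] 1"

lemma finite_quarter_walks:
  assumes "finite S"
  shows "finite (quarter_walks S n)"
proof -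
  let ?f = "\<lambda>w::(int \<times> int) list. map (\<lambda>i. w ! Suc i - w ! i) [0..<n]"
  have "?f ` quarter_walks S n \<subseteq> {xs. set xs \<subseteq> S \<and> length xs = n}"
    by (auto simp: quarter_walks_def)
  then have fin: "finite (?f ` quarter_walks S n)"
    using finite_lists_length_eq[OF assms] finite_subset by blast
  have "inj_on ?f (quarter_walks S n)"
  proof (rule inj_onI)
    fix u w assume u: "u \<in> quarter_walks S n" and w: "w \<in> quarter_walks S n"
      and eq: "?f u = ?f w"
    have step: "u ! Suc i - u ! i = w ! Suc i - w ! i" if "i < n" for i
      using eq that by (simp add: list_eq_iff_nth_eq)
    have "u ! i = w ! i" if "i \<le> n" for i
      using that
    proof (induction i)
      case 0
      then show ?case using u w by (simp add: quarter_walks_def)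
    next
      case (Suc i)
      then show ?case using step[of i] by simp
    qed
    then show "u = w"
      using u w by (intro nth_equalityI) (auto simp: quarter_walks_def)
  qed
  with fin show ?thesis by (rule finite_imageD)
qed

lemma num_walks_eq_0:
  assumes "h > n \<or> v > n"
  shows "num_walks S n k l h v = 0"
proof -
  have le: "card {i. 1 \<le> i \<and> i < Suc n \<and> P i} \<le> n" for P
  proof -
    have "card {i. 1 \<le> i \<and> i < Suc n \<and> P i} \<le> card {1..n}"
      by (rule card_mono) auto
    then show ?thesis by simp
  qed
  have "hvisits w \<le> n \<and> vvisits w \<le> n" if "w \<in> quarter_walks S n" for w
    using that le by (simp add: quarter_walks_def hvisits_def vvisits_def)
  with assms have "{w \<in> quarter_walks S n. w ! n = (k, l) \<and> hvisits w = h \<and> vvisits w = v} = {}"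
    by fastforce
  then show ?thesis unfolding num_walks_def by (simp only: card.empty)
qed

end

theory Submission imports Defs begin

text \<open>
  The argument applies to every set of small steps that is invariant under \<open>(i, j) \<mapsto> (- i, j)\<close>, as
  all twelve are, and to every weight \<open>a \<noteq> 1\<close> in a field of characteristic \<open>0\<close>.

  With \<open>b = 1\<close> the line \<open>x = 0\<close> carries no weight; it is merely a wall, and the reflection
  principle removes it.  If \<open>H(t, x)\<close> counts the walks in the upper half plane that start and end
  on \<open>y = 0\<close>, with weight \<open>a\<close> per return and with \<open>x\<close> marking the abscissa of the endpoint, then
  \<open>G(t; a, 1)\<close> is the coefficient of \<open>x\<^sup>0\<close> minus the coefficient of \<open>x\<^sup>-\<^sup>2\<close> in \<open>H\<close>, that is, the
  residue at \<open>x = 0\<close> of \<open>(x\<^sup>-\<^sup>1 - x) H\<close> (\<open>reflection_principle\<close>).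

  A walk in the half plane is one-dimensional up to Laurent polynomial step weights.  Write
  \<open>A\<^sub>j\<close> for the sum of \<open>x\<^sup>i\<close> over the steps \<open>(i, j)\<close>.  Decomposing at the passages between levels
  shows that the walks ending at height \<open>m\<close> are counted by \<open>H r\<^sup>m\<close>, where
  \<open>r = t (A\<^sub>1 + A\<^sub>0 r + A\<^sub>-\<^sub>1 r\<^sup>2)\<close> (\<open>half_plane_gf\<close>).  Therefore
  \<open>H = 2 / (2 - a - a t A\<^sub>0 + a s)\<close> with \<open>s\<^sup>2 = (1 - t A\<^sub>0)\<^sup>2 - 4 t\<^sup>2 A\<^sub>1 A\<^sub>-\<^sub>1\<close>, so that \<open>H\<close> is
  algebraic over the rational functions in \<open>t\<close> and \<open>x\<close>.

  It remains to see that the residue in \<open>x\<close> of such a function is D-finite in \<open>t\<close>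
  (\<open>D_finite_residue\<close>).  This is a dimension count in the style of Lipshitz and Bernstein.  Applying the
  \<open>N\<^sup>3\<close> operators \<open>t\<^sup>i \<partial>\<^sub>t\<^sup>j \<partial>\<^sub>x\<^sup>k\<close> with \<open>i, j, k < N\<close> to \<open>F\<close> produces, up to a common denominator,
  polynomial combinations of \<open>1\<close> and \<open>s\<close> with degrees of order \<open>N\<close>, hence elements of a space of
  dimension \<open>O(N\<^sup>2)\<close>.  So some non-trivial combination of the operators, with coefficients free
  of \<open>x\<close>, annihilates \<open>F\<close>.  If \<open>k\<close> is the least order of \<open>\<partial>\<^sub>x\<close> in it, multiplying by \<open>x\<^sup>k\<close> and
  taking the residue kills all terms of higher order in \<open>\<partial>\<^sub>x\<close> and turns \<open>\<partial>\<^sub>x\<^sup>k\<close> into the non-zero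
  constant \<open>(- 1)\<^sup>k k!\<close>; what is left is a differential equation in \<open>t\<close> for the residue.
\<close>

unbundle fps_syntax

section \<open>Reflection in the vertical boundary\<close>

definition weighted_walks :: "(int \<times> int) set \<Rightarrow> 'a::comm_ring_1 \<Rightarrow> nat \<Rightarrow> int \<times> int \<Rightarrow> 'a" where
  "weighted_walks S a n p = (\<Sum>w | w \<in> quarter_walks S n \<and> w ! n = p. a ^ hvisits w)"

lemma visits_le:
  assumes "length w = Suc n"
  shows "hvisits w \<le> n" "vvisits w \<le> n"
proof -
  have "card {i. 1 \<le> i \<and> i < length w \<and> P i} \<le> card {1..n}" for P
    using assms by (intro card_mono) auto
  then show "hvisits w \<le> n" "vvisits w \<le> n" by (simp_all add: hvisits_def vvisits_def)
qed

lemma walk_gf_eq_weighted_walks: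
  assumes "finite S"
  shows "walk_gf S a 1 $ n = weighted_walks S a n (0, 0)"
proof -
  define W where "W = {w. w \<in> quarter_walks S n \<and> w ! n = (0, 0)}"
  have fin: "finite W" using finite_quarter_walks[OF assms] by (auto simp: W_def)
  have "weighted_walks S a n (0, 0)
      = (\<Sum>(h, v)\<in>{..n} \<times> {..n}. \<Sum>w | w \<in> W \<and> (hvisits w, vvisits w) = (h, v). a ^ hvisits w)"
    unfolding weighted_walks_def W_def[symmetric] case_prod_unfold prod.collapse
    by (rule sum.group[symmetric])
      (use fin in \<open>auto simp: W_def quarter_walks_def visits_le\<close>)
  also have "\<dots> = (\<Sum>(h, v)\<in>{..n} \<times> {..n}. of_nat (num_walks S n 0 0 h v) * a ^ h)"
    by (intro sum.cong refl) (auto simp: num_walks_def W_def conj_assoc)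
  finally show ?thesis by (simp add: walk_gf_def sum.cartesian_product)
qed

lemma weighted_walks_0: "weighted_walks S a 0 p = (if p = (0, 0) then 1 else 0)"
proof -
  have "quarter_walks S 0 = {[(0, 0)]}"
    by (auto simp: quarter_walks_def length_Suc_conv)
  moreover have "hvisits [(0, 0)] = 0" by (auto simp: hvisits_def)
  moreover have "{w. w \<in> {[(0, 0)]} \<and> w ! 0 = p} = (if p = (0, 0) then {[(0, 0)]} else {})"
    by auto
  ultimately show ?thesis by (simp add: weighted_walks_def)
qed

lemma weighted_walks_outside:
  assumes "\<not> (0 \<le> fst p \<and> 0 \<le> snd p)"
  shows "weighted_walks S a n p = 0"
proof -
  have "{w. w \<in> quarter_walks S n \<and> w ! n = p} = {}"
    using assms by (force simp: quarter_walks_def)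
  then show ?thesis by (simp add: weighted_walks_def del: Collect_empty_eq)
qed

lemma hvisits_append:
  assumes "w \<noteq> []"
  shows "hvisits (w @ [p]) = hvisits w + (if snd p = 0 then 1 else 0)"
proof -
  have "{i. 1 \<le> i \<and> i < length (w @ [p]) \<and> snd ((w @ [p]) ! i) = 0}
      = {i. 1 \<le> i \<and> i < length w \<and> snd (w ! i) = 0} \<union> (if snd p = 0 then {length w} else {})"
    using assms by (auto simp: nth_append less_Suc_eq Suc_le_eq split: if_splits)
  then show ?thesis by (simp add: hvisits_def)
qed

lemma quarter_walks_append:
  assumes "0 \<le> fst p" "0 \<le> snd p"
  shows "w @ [p] \<in> quarter_walks S (Suc n) \<longleftrightarrow> w \<in> quarter_walks S n \<and> p - w ! n \<in> S"
  using assms unfolding quarter_walks_def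
  by (auto simp: nth_append All_less_Suc)

text \<open>
  Removing the last vertex.  Whether that vertex counts as a visit depends only on its height, so the
  weight factors.
\<close>

lemma weighted_walks_Suc:
  fixes a :: "'a::comm_ring_1"
  assumes "finite S" "0 \<le> fst p" "0 \<le> snd p"
  shows "weighted_walks S a (Suc n) p =
    (if snd p = 0 then a else 1) * (\<Sum>s\<in>S. weighted_walks S a n (p - s))"
proof -
  define W where "W = {w \<in> quarter_walks S n. p - w ! n \<in> S}"
  have fin: "finite W" using finite_quarter_walks[OF assms(1)] by (auto simp: W_def)
  have "{w. w \<in> quarter_walks S (Suc n) \<and> w ! Suc n = p} = (\<lambda>w. w @ [p]) ` W" (is "?L = ?R")
  proof
    show "?R \<subseteq> ?L"
      using assms by (auto simp: W_def quarter_walks_append) (auto simp: quarter_walks_def nth_append)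
    show "?L \<subseteq> ?R"
    proof
      fix w assume w: "w \<in> ?L"
      then have len: "length w = Suc (Suc n)" by (simp add: quarter_walks_def)
      then obtain u q where u: "w = u @ [q]" by (cases w rule: rev_cases) auto
      moreover from this len w have "q = p" by (auto simp: nth_append)
      ultimately show "w \<in> ?R" using w assms by (auto simp: W_def quarter_walks_append)
    qed
  qed
  then have "weighted_walks S a (Suc n) p = (\<Sum>w\<in>W. a ^ hvisits (w @ [p]))"
    by (simp add: weighted_walks_def sum.reindex inj_on_def)
  also have "\<dots> = (\<Sum>w\<in>W. (if snd p = 0 then a else 1) * a ^ hvisits w)"
    by (intro sum.cong refl, subst hvisits_append) (auto simp: W_def quarter_walks_def)
  also have "\<dots> = (if snd p = 0 then a else 1) * (\<Sum>w\<in>W. a ^ hvisits w)"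
    by (simp add: sum_distrib_left)
  also have "(\<Sum>w\<in>W. a ^ hvisits w) = (\<Sum>s\<in>S. \<Sum>w | w \<in> W \<and> p - w ! n = s. a ^ hvisits w)"
    by (rule sum.group[symmetric]) (use fin assms(1) in \<open>auto simp: W_def\<close>)
  also have "\<dots> = (\<Sum>s\<in>S. weighted_walks S a n (p - s))"
    unfolding weighted_walks_def
    by (intro sum.cong refl) (auto simp: W_def algebra_simps)
  finally show ?thesis .
qed

definition step_poly :: "(int \<times> int) set \<Rightarrow> int \<Rightarrow> 'a::comm_ring_1 fls" where
  "step_poly S j = (\<Sum>i | i \<in> {-1, 0, 1} \<and> (i, j) \<in> S. fls_X_intpow i)"

text \<open>
  The weighted walks of length \<open>n\<close> in the upper half plane that end at height \<open>l\<close>, with \<open>x\<close> marking the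
  abscissa of the endpoint, given by the recursion on the last step.
\<close>

primrec half_plane :: "(int \<times> int) set \<Rightarrow> 'a::comm_ring_1 \<Rightarrow> nat \<Rightarrow> int \<Rightarrow> 'a fls" where
  "half_plane S a 0 l = (if l = 0 then 1 else 0)"
| "half_plane S a (Suc n) l = (if l < 0 then 0 else
     (if l = 0 then fls_const a else 1) *
       (\<Sum>j\<in>{-1, 0, 1}. step_poly S j * half_plane S a n (l - j)))"

lemma half_plane_neg: "l < 0 \<Longrightarrow> half_plane S a n l = 0"
  by (cases n) auto

lemma step_poly_mult_nth:
  "(step_poly S j * f) $$ k = (\<Sum>i | i \<in> {-1, 0, 1} \<and> (i, j) \<in> S. f $$ (k - i))"
  by (simp add: step_poly_def sum_distrib_right fls_nth_sum fls_X_intpow_times_conv_shift)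

lemma sum_small_steps:
  fixes f :: "int \<times> int \<Rightarrow> 'b::comm_monoid_add"
  assumes "S \<subseteq> {-1, 0, 1} \<times> {-1, 0, 1}"
  shows "(\<Sum>j\<in>{-1, 0, 1}. \<Sum>i | i \<in> {-1, 0, 1} \<and> (i, j) \<in> S. f (i, j)) = (\<Sum>s\<in>S. f s)"
proof -
  have "(\<Sum>j\<in>{-1, 0, 1}. \<Sum>i | i \<in> {-1, 0, 1} \<and> (i, j) \<in> S. f (i, j))
      = (\<Sum>(j, i)\<in>(SIGMA j:{-1, 0, 1}. {i. i \<in> {-1, 0, 1} \<and> (i, j) \<in> S}). f (i, j))"
    by (rule sum.Sigma) auto
  also have "\<dots> = (\<Sum>s\<in>S. f s)"
    by (rule sum.reindex_bij_witness[of _ prod.swap prod.swap]) (use assms in auto)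
  finally show ?thesis .
qed

lemma half_plane_Suc_nth:
  fixes a :: "'a::comm_ring_1"
  assumes "S \<subseteq> {-1, 0, 1} \<times> {-1, 0, 1}" "0 \<le> l"
  shows "half_plane S a (Suc n) l $$ k =
    (if l = 0 then a else 1) * (\<Sum>s\<in>S. half_plane S a n (l - snd s) $$ (k - fst s))"
proof -
  have c: "((if b then fls_const a else 1) * f) $$ k = (if b then a else 1) * f $$ k" for b f
    by simp
  have "half_plane S a (Suc n) l $$ k = ((if l = 0 then fls_const a else 1) *
       (\<Sum>j\<in>{-1, 0, 1}. step_poly S j * half_plane S a n (l - j))) $$ k"
    using assms(2) by simp
  also have "\<dots> = (if l = 0 then a else 1) *
      (\<Sum>j\<in>{-1, 0, 1}. \<Sum>i | i \<in> {-1, 0, 1} \<and> (i, j) \<in> S. half_plane S a n (l - j) $$ (k - i))"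
    unfolding c fls_nth_sum step_poly_mult_nth ..
  finally show ?thesis
    using sum_small_steps[OF assms(1), of "\<lambda>(i, j). half_plane S a n (l - j) $$ (k - i)"]
    by (simp add: case_prod_unfold)
qed

text \<open>
  Reflection in the line \<open>x = - 1\<close>, which a walk with small steps must meet before it can leave the
  quadrant on the left.  The right-hand side is antisymmetric under this reflection and satisfies the
  recursion of the half-plane walks; on \<open>k = - 1\<close> it vanishes, as does the number of quarter-plane walks,
  so both sides agree by induction on the length.  The claim includes \<open>k = - 1\<close> because the
  recursion at \<open>k = 0\<close> refers to it.
\<close>

lemma reflection_principle:
  fixes a :: "'a::comm_ring_1"
  assumes S: "S \<subseteq> {-1, 0, 1} \<times> {-1, 0, 1}" and sym: "\<And>i j. (i, j) \<in> S \<Longrightarrow> (- i, j) \<in> S"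
    and "k \<ge> -1"
  shows "weighted_walks S a n (k, l) = half_plane S a n l $$ k - half_plane S a n l $$ (- 2 - k)"
  using assms(3)
proof (induction n arbitrary: k l)
  case 0
  then show ?case by (auto simp: weighted_walks_0)
next
  case (Suc n)
  have fin: "finite S" using S by (rule finite_subset) auto
  consider "l < 0" | "k = -1" | "l \<ge> 0" "k \<ge> 0" using Suc.prems by linarith
  then show ?case
  proof cases
    case 3
    define c where "c = (if l = 0 then a else 1)"
    have "weighted_walks S a (Suc n) (k, l)
        = c * (\<Sum>s\<in>S. weighted_walks S a n (k - fst s, l - snd s))"
      using 3 by (subst weighted_walks_Suc[OF fin]) (auto simp: c_def minus_prod_def)
    also have "(\<Sum>s\<in>S. weighted_walks S a n (k - fst s, l - snd s)) =
        (\<Sum>s\<in>S. half_plane S a n (l - snd s) $$ (k - fst s)) -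
        (\<Sum>s\<in>S. half_plane S a n (l - snd s) $$ (- 2 - (k - fst s)))"
      unfolding sum_subtractf[symmetric]
      using S 3 by (intro sum.cong refl Suc.IH) force
    also have "(\<Sum>s\<in>S. half_plane S a n (l - snd s) $$ (- 2 - (k - fst s))) =
        (\<Sum>s\<in>S. half_plane S a n (l - snd s) $$ (- 2 - k - fst s))"
      by (rule sum.reindex_bij_witness[of _ "\<lambda>(i, j). (- i, j)" "\<lambda>(i, j). (- i, j)"])
        (auto simp: sym algebra_simps)
    finally show ?thesis
      using 3 by (simp only: half_plane_Suc_nth[OF S] c_def right_diff_distrib)
  qed (auto simp: weighted_walks_outside half_plane_neg)
qed

section \<open>The generating function of half-plane walks\<close>

text \<open>
  The coefficients of the power series solution of \<open>r = t (u + v r + w r\<^sup>2)\<close>.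
\<close>

fun quadratic_root_coeff :: "'b::comm_ring_1 \<Rightarrow> 'b \<Rightarrow> 'b \<Rightarrow> nat \<Rightarrow> 'b" where
  "quadratic_root_coeff u v w 0 = 0"
| "quadratic_root_coeff u v w (Suc n) = (if n = 0 then u else 0) + v * quadratic_root_coeff u v w n
     + w * (\<Sum>i\<le>n. quadratic_root_coeff u v w i * quadratic_root_coeff u v w (n - i))"

lemma ex_quadratic_root:
  fixes u v w :: "'b::comm_ring_1"
  shows "\<exists>r. r = fps_X * (fps_const u + fps_const v * r + fps_const w * r ^ 2)"
proof
  let ?r = "Abs_fps (quadratic_root_coeff u v w)"
  show "?r = fps_X * (fps_const u + fps_const v * ?r + fps_const w * ?r ^ 2)"
  proof (rule fps_ext)
    fix n
    have "(?r ^ 2) $ m = (\<Sum>i\<le>m. quadratic_root_coeff u v w i * quadratic_root_coeff u v w (m - i))"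
      for m by (simp add: power2_eq_square fps_mult_nth atLeast0AtMost)
    then show "?r $ n = (fps_X * (fps_const u + fps_const v * ?r + fps_const w * ?r ^ 2)) $ n"
      by (cases n) auto
  qed
qed

text \<open>
  A walk ending at height \<open>m\<close> splits at its last visits to the heights \<open>0, \<dots>, m - 1\<close>: the first part
  returns to height \<open>0\<close> and is counted by \<open>H\<close>, each further part consists of a step to the next height and
  an excursion above it, and is counted by \<open>r\<close>.  In place of this bijection, the proof checks that the series \<open>H r\<^sup>m\<close>
  satisfy the recursion that determines the half-plane walks: at height \<open>0\<close> this is the equation of \<open>H\<close>, at all
  other heights it is the equation of \<open>r\<close> multiplied by \<open>H r\<^sup>m\<^sup>-\<^sup>1\<close>.
\<close>

lemma half_plane_gf:
  fixes H r :: "'a::comm_ring_1 fls fps"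
  assumes r: "r = fps_X * (fps_const (step_poly S 1) + fps_const (step_poly S 0) * r
                   + fps_const (step_poly S (-1)) * r ^ 2)"
    and H: "H = 1 + fps_X * (fps_const (fls_const a) * (fps_const (step_poly S 0) * H
                   + fps_const (step_poly S (-1)) * (H * r)))"
  shows "(H * r ^ m) $ n = half_plane S a n (int m)"
proof (induction n arbitrary: m)
  case 0
  have "r $ 0 = 0" by (subst r) simp
  moreover have "H $ 0 = 1" by (subst H) simp
  ultimately show ?case by (cases m) auto
next
  case (Suc n)
  show ?case
  proof (cases m)
    case 0
    have "H $ Suc n = fls_const a * (step_poly S 0 * H $ n + step_poly S (-1) * (H * r) $ n)"
      by (subst H) (simp del: fps_mult_nth_0)
    also have "H $ n = half_plane S a n 0" using Suc[of 0] by simp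
    also have "(H * r) $ n = half_plane S a n 1" using Suc[of 1] by simp
    finally show ?thesis using 0 by (simp add: half_plane_neg add_ac)
  next
    case (Suc k)
    have "H * r ^ m = H * r ^ k * r" by (simp add: Suc mult_ac)
    also have "\<dots> = fps_X * (fps_const (step_poly S 1) * (H * r ^ k)
        + fps_const (step_poly S 0) * (H * r ^ Suc k)
        + fps_const (step_poly S (-1)) * (H * r ^ Suc (Suc k)))"
      by (subst r) (simp add: algebra_simps power2_eq_square)
    finally have "(H * r ^ m) $ Suc n = step_poly S 1 * (H * r ^ k) $ n
        + step_poly S 0 * (H * r ^ Suc k) $ n + step_poly S (-1) * (H * r ^ Suc (Suc k)) $ n"
      by (simp del: power_Suc)
    then show ?thesis unfolding Suc.IH using Suc by (simp add: add_ac)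
  qed
qed

section \<open>Power series in \<open>t\<close> over Laurent series in \<open>x\<close>\<close>

text \<open>
  Throughout, a series in \<open>t\<close> and \<open>x\<close> is a power series in \<open>t\<close> whose coefficients are Laurent series in
  \<open>x\<close>: residues require negative powers of \<open>x\<close>, and over a field
  this ring has no zero divisors.
\<close>

definition xderiv :: "'a::comm_ring_1 fls fps \<Rightarrow> 'a fls fps" where
  "xderiv f = Abs_fps (\<lambda>n. fls_deriv (f $ n))"

definition xcoeff :: "int \<Rightarrow> 'a::comm_ring_1 fls fps \<Rightarrow> 'a fps" where
  "xcoeff j f = Abs_fps (\<lambda>n. (f $ n) $$ j)"

definition scl :: "'a::comm_ring_1 \<Rightarrow> 'a fls fps \<Rightarrow> 'a fls fps" where
  "scl c f = fps_const (fls_const c) * f"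

lemma xderiv_nth [simp]: "xderiv f $ n = fls_deriv (f $ n)"
  by (simp add: xderiv_def)

lemma xcoeff_nth [simp]: "xcoeff j f $ n = (f $ n) $$ j"
  by (simp add: xcoeff_def)

lemma scl_nth [simp]: "scl c f $ n = fls_const c * (f $ n)"
  by (simp add: scl_def)

lemma xderiv_add: "xderiv (f + g) = xderiv f + xderiv g"
  by (simp add: fps_eq_iff)

lemma fls_deriv_sum: "fls_deriv (sum f A) = (\<Sum>x\<in>A. fls_deriv (f x))"
  by (induction A rule: infinite_finite_induct) auto

lemma xderiv_mult: "xderiv (f * g) = f * xderiv g + xderiv f * g"
  by (simp add: fps_eq_iff fps_mult_nth fls_deriv_sum sum.distrib)

lemma xderiv_scl: "xderiv (scl c f) = scl c (xderiv f)"
  by (simp add: fps_eq_iff)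

lemma fps_deriv_scl: "fps_deriv (scl c f) = scl c (fps_deriv f)"
  by (simp add: scl_def)

lemma scl_mult_left: "scl c f * g = scl c (f * g)"
  by (simp add: scl_def mult.assoc)

lemma scl_mult_right: "f * scl c g = scl c (f * g)"
  by (simp add: scl_def mult_ac)

lemma xcoeff_scl: "xcoeff j (scl c f) = fps_const c * xcoeff j f"
  by (simp add: fps_eq_iff)

lemma xcoeff_0 [simp]: "xcoeff j 0 = 0"
  by (simp add: fps_eq_iff)

lemma xcoeff_add: "xcoeff j (f + g) = xcoeff j f + xcoeff j g"
  by (simp add: fps_eq_iff)

lemma xcoeff_sum: "xcoeff j (sum f A) = (\<Sum>x\<in>A. xcoeff j (f x))"
  by (induction A rule: infinite_finite_induct) (auto simp: xcoeff_add)

lemma xcoeff_X_power: "xcoeff j (fps_X ^ n * f) = fps_X ^ n * xcoeff j f"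
  by (simp add: fps_eq_iff fps_X_power_mult_nth)

lemma of_nat_times_nth: "(of_nat n * f) $$ j = of_nat n * (f $$ j :: 'a::comm_ring_1)"
  by (simp add: fls_of_nat)

lemma xcoeff_deriv_funpow: "xcoeff j ((fps_deriv ^^ n) f) = fps_nth_deriv n (xcoeff j f)"
proof (induction n)
  case (Suc n)
  have "xcoeff j (fps_deriv g) = fps_deriv (xcoeff j g)" for g :: "'a fls fps"
    by (simp add: fps_eq_iff of_nat_times_nth del: of_nat_Suc)
  then show ?case using Suc by (simp only: funpow.simps comp_apply fps_nth_deriv_commute)
qed auto

text \<open>
  Integration by parts in terms of coefficients.  The residue of \<open>x\<^sup>k f\<close> is the coefficient of
  \<open>x\<^sup>-\<^sup>1\<^sup>-\<^sup>k\<close> in \<open>f\<close>, and the factor \<open>(- k) (- k + 1) \<cdots> (- k + n - 1)\<close> below vanishes as soon as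
  \<open>n > k\<close>: this makes the residue of \<open>x\<^sup>k \<partial>\<^sub>x\<^sup>n f\<close> disappear for all \<open>n > k\<close>.
\<close>

lemma xcoeff_xderiv_funpow:
  "xcoeff (-1 - int k) ((xderiv ^^ n) f) =
     fps_const (pochhammer (- of_nat k) n) * xcoeff (int n - 1 - int k) f"
proof (induction n arbitrary: f)
  case (Suc n)
  have "xcoeff (-1 - int k) ((xderiv ^^ Suc n) f) = xcoeff (-1 - int k) ((xderiv ^^ n) (xderiv f))"
    by (simp add: funpow_Suc_right del: funpow.simps)
  also have "\<dots> = fps_const (pochhammer (- of_nat k) n) * xcoeff (int n - 1 - int k) (xderiv f)"
    by (rule Suc)
  also have "xcoeff (int n - 1 - int k) (xderiv f) =
      fps_const (- of_nat k + of_nat n) * xcoeff (int (Suc n) - 1 - int k) f"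
    by (simp add: fps_eq_iff)
  finally show ?case by (simp add: pochhammer_Suc mult.assoc[symmetric])
qed auto

section \<open>Laurent polynomials of bounded degree\<close>

interpretation xt: vector_space "scl :: 'a::field \<Rightarrow> 'a fls fps \<Rightarrow> 'a fls fps"
  by unfold_locales
    (auto simp: fps_eq_iff algebra_simps fls_const_mult_const[symmetric] fls_plus_const[symmetric]
      simp del: fls_const_mult_const fls_plus_const)

text \<open>
  A relation for a family instead of a set of vectors: a family with a repetition satisfies the
  relation \<open>v i - v j = 0\<close>, one without repetitions has a linearly dependent range.
\<close>

lemma (in vector_space) ex_nontrivial_relation:
  assumes "finite I" "finite G" "card G < card I" "\<And>i. i \<in> I \<Longrightarrow> v i \<in> span G"
  shows "\<exists>c. (\<exists>i\<in>I. c i \<noteq> 0) \<and> (\<Sum>i\<in>I. scale (c i) (v i)) = 0"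
proof (cases "inj_on v I")
  case True
  have "dependent (v ` I)"
    using independent_span_bound[of G "v ` I"] assms card_image[OF True] by auto
  then obtain u where "\<exists>x\<in>v ` I. u x \<noteq> 0" "(\<Sum>x\<in>v ` I. scale (u x) x) = 0"
    using dependent_finite[of "v ` I"] assms(1) by auto
  then show ?thesis
    by (intro exI[of _ "u \<circ> v"]) (auto simp: sum.reindex[OF True])
next
  case False
  then obtain i j where ij: "i \<in> I" "j \<in> I" "i \<noteq> j" "v i = v j"
    by (auto simp: inj_on_def)
  define c :: "'c \<Rightarrow> 'a" where "c = (\<lambda>k. if k = i then 1 else if k = j then -1 else 0)"
  have "(\<Sum>k\<in>I. scale (c k) (v k)) = (\<Sum>k\<in>{i, j}. scale (c k) (v k))"
    using ij assms(1) by (intro sum.mono_neutral_right) (auto simp: c_def)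
  also have "\<dots> = 0" using ij by (auto simp: c_def)
  finally show ?thesis using ij by (intro exI[of _ c]) (auto simp: c_def)
qed

lemma xt_span_image:
  assumes add: "\<And>f g. L (f + g) = L f + L g" and scl: "\<And>c f. L (scl c f) = scl c (L f)"
    and gen: "\<And>g. g \<in> A \<Longrightarrow> L g \<in> xt.span B" and f: "f \<in> xt.span A"
  shows "L f \<in> xt.span B"
  using f
proof (induction rule: xt.span_induct_alt)
  case base
  have "L 0 + L 0 = L 0 + 0" using add[of 0 0] by simp
  then have "L 0 = 0" by (simp only: add_left_cancel)
  then show ?case by (simp add: xt.span_zero)
next
  case (step c x y)
  then show ?case using gen by (simp add: add scl xt.span_add xt.span_scale)
qed

definition mono_tx :: "nat \<Rightarrow> int \<Rightarrow> 'a::field fls fps" where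
  "mono_tx i j = fps_X ^ i * fps_const (fls_X_intpow j)"

text \<open>
  The span of these generators consists of the combinations of elements of \<open>B\<close> whose coefficients
  are Laurent polynomials of degree at most \<open>d\<close> in \<open>t\<close> and in \<open>x\<^sup>\<plusminus>\<^sup>1\<close>.  For \<open>B = {1}\<close> these are the Laurent
  polynomials themselves.  Negative powers of \<open>x\<close> make the Laurent polynomials closed under \<open>\<partial>\<^sub>x\<close> and let
  the step polynomials in without clearing denominators.
\<close>

definition box_gens :: "nat \<Rightarrow> 'a::field fls fps set \<Rightarrow> 'a fls fps set" where
  "box_gens d B = (\<lambda>((i, j), b). mono_tx i j * b) ` (({..d} \<times> {- int d..int d}) \<times> B)"

abbreviation box_span :: "nat \<Rightarrow> 'a::field fls fps set \<Rightarrow> 'a fls fps set" where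
  "box_span d B \<equiv> xt.span (box_gens d B)"

lemma mono_tx_mult: "mono_tx i j * mono_tx k l = mono_tx (i + k) (j + l)"
proof -
  have "mono_tx i j * mono_tx k l
      = fps_X ^ (i + k) * (fps_const (fls_X_intpow j) * fps_const (fls_X_intpow l) :: 'a fls fps)"
    unfolding mono_tx_def power_add by (simp only: mult_ac)
  also have "\<dots> = mono_tx (i + k) (j + l)"
    unfolding mono_tx_def fps_const_mult fls_X_intpow_times_fls_X_intpow ..
  finally show ?thesis .
qed

lemma mono_tx_00: "mono_tx 0 0 = 1"
  by (simp add: mono_tx_def)

lemma mono_tx_nth: "mono_tx i j $ n = (if n = i then fls_X_intpow j else 0)"
  by (auto simp: mono_tx_def fps_X_power_mult_nth)

lemma fps_deriv_mono_tx: "fps_deriv (mono_tx i j) = scl (of_nat i) (mono_tx (i - 1) j)"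
  by (cases i) (auto simp: fps_eq_iff mono_tx_nth fls_of_nat simp del: of_nat_Suc)

lemma xderiv_mono_tx: "xderiv (mono_tx i j) = scl (of_int j) (mono_tx i (j - 1))"
proof -
  have "fls_deriv (fls_X_intpow j) = fls_const (of_int j) * (fls_X_intpow (j - 1) :: 'a fls)"
  proof (rule fls_eqI)
    fix n
    show "fls_deriv (fls_X_intpow j) $$ n
        = (fls_const (of_int j) * (fls_X_intpow (j - 1) :: 'a fls)) $$ n"
      by (cases "n = j - 1") auto
  qed
  then show ?thesis by (auto simp: fps_eq_iff mono_tx_nth)
qed

lemma box_gensE:
  assumes "g \<in> box_gens d B"
  obtains i j b where "g = mono_tx i j * b" "i \<le> d" "\<bar>j\<bar> \<le> int d" "b \<in> B"
proof -
  from assms obtain i j b where *: "g = mono_tx i j * b" "i \<le> d" "j \<in> {- int d..int d}" "b \<in> B"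
    unfolding box_gens_def by auto
  then show ?thesis using that[of i j b] by auto
qed

lemma finite_box_gens: "finite B \<Longrightarrow> finite (box_gens d B)"
  by (simp add: box_gens_def)

text \<open>
  The quadratic growth in \<open>d\<close> is what the dimension count rests on.
\<close>

lemma card_box_gens_le:
  assumes "finite B"
  shows "card (box_gens d B) \<le> Suc d * (2 * d + 1) * card B"
proof -
  have "card (box_gens d B) \<le> card (({..d} \<times> {- int d..int d}) \<times> B)"
    unfolding box_gens_def using assms by (intro card_image_le) auto
  also have "\<dots> = Suc d * nat (2 * int d + 1) * card B"
    by (simp add: card_cartesian_product)
  also have "nat (2 * int d + 1) = 2 * d + 1" by simp
  finally show ?thesis .
qed

lemma mono_tx_in_box_span:
  assumes "i \<le> d" "\<bar>j\<bar> \<le> int d" "b \<in> B"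
  shows "mono_tx i j * b \<in> box_span d B"
  using assms by (intro xt.span_base) (force simp: box_gens_def)

lemma box_span_mono: "d \<le> e \<Longrightarrow> f \<in> box_span d B \<Longrightarrow> f \<in> box_span e B"
  using xt.span_mono[of "box_gens d B" "box_gens e B"] by (force simp: box_gens_def)

text \<open>
  Both factors are combinations of generators, and the product is bilinear.
\<close>

lemma box_span_mult:
  assumes "p \<in> box_span d {1}" "f \<in> box_span e B"
  shows "p * f \<in> box_span (d + e) B"
proof -
  have gens: "g * h \<in> box_span (d + e) B" if "g \<in> box_gens d {1}" "h \<in> box_gens e B" for g h
  proof -
    from that(1) obtain i j where "g = mono_tx i j" "i \<le> d" "\<bar>j\<bar> \<le> int d"
      by (auto elim!: box_gensE)
    moreover from that(2) obtain k l b where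
        "h = mono_tx k l * b" "k \<le> e" "\<bar>l\<bar> \<le> int e" "b \<in> B"
      by (elim box_gensE)
    ultimately show ?thesis
      using mono_tx_in_box_span[of "i + k" "d + e" "j + l" b B]
      by (auto simp: mult.assoc[symmetric] mono_tx_mult)
  qed
  have "p * h \<in> box_span (d + e) B" if "h \<in> box_gens e B" for h
    using assms(1)
    by (rule xt_span_image[where L = "\<lambda>p. p * h", rotated 3])
      (use gens that in \<open>auto simp: distrib_right scl_mult_left\<close>)
  then show ?thesis
    by (intro xt_span_image[OF _ _ _ assms(2), where L = "\<lambda>f. p * f"])
      (auto simp: distrib_left scl_mult_right)
qed

lemma box_span_base: "b \<in> B \<Longrightarrow> b \<in> box_span 0 B"
  using mono_tx_in_box_span[of 0 0 0 b B] by (simp add: mono_tx_00)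

lemma mono_tx_in_box_span_1: "i \<le> d \<Longrightarrow> \<bar>j\<bar> \<le> int d \<Longrightarrow> mono_tx i j \<in> box_span d {1}"
  using mono_tx_in_box_span[of i d j 1 "{1}"] by simp

lemma fps_deriv_box_span_1:
  assumes "f \<in> box_span d {1}" shows "fps_deriv f \<in> box_span (d + 1) {1}"
proof (rule xt_span_image[OF _ _ _ assms])
  fix g :: "'a fls fps" assume "g \<in> box_gens d {1}"
  then obtain i j where "g = mono_tx i j" "i \<le> d" "\<bar>j\<bar> \<le> int d"
    by (auto elim!: box_gensE)
  then show "fps_deriv g \<in> box_span (d + 1) {1}"
    by (auto simp: fps_deriv_mono_tx intro!: xt.span_scale mono_tx_in_box_span_1)
qed (auto simp: fps_deriv_scl)

lemma xderiv_box_span_1: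
  assumes "f \<in> box_span d {1}" shows "xderiv f \<in> box_span (d + 1) {1}"
proof (rule xt_span_image[OF _ _ _ assms])
  fix g :: "'a fls fps" assume "g \<in> box_gens d {1}"
  then obtain i j where "g = mono_tx i j" "i \<le> d" "\<bar>j\<bar> \<le> int d"
    by (auto elim!: box_gensE)
  then show "xderiv g \<in> box_span (d + 1) {1}"
    by (auto simp: xderiv_mono_tx intro!: xt.span_scale mono_tx_in_box_span_1)
qed (auto simp: xderiv_scl xderiv_add)

section \<open>Residues of holonomic functions are D-finite\<close>

text \<open>
  The quotient rule, with denominators cleared.  Think of \<open>f\<close> as \<open>g / E\<^sup>m\<close> for a combination \<open>g\<close> of the
  elements of \<open>B\<close>; then \<open>E\<^sup>m\<^sup>+\<^sup>1 D f = E D g - m (D E) g\<close>.  If \<open>D\<close> maps \<open>B\<close> into the span of \<open>B\<close> with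
  denominator \<open>E\<close>, each derivation costs one more power of \<open>E\<close> and an increase of the degree that does not
  depend on \<open>f\<close>.
\<close>

lemma box_span_derivation:
  fixes D :: "'a::field fls fps \<Rightarrow> 'a fls fps"
  assumes add: "\<And>f g. D (f + g) = D f + D g" and scl: "\<And>c f. D (scl c f) = scl c (D f)"
    and mult: "\<And>f g. D (f * g) = f * D g + D f * g"
    and poly: "\<And>d f. f \<in> box_span d {1} \<Longrightarrow> D f \<in> box_span (d + 1) {1}"
    and E: "E \<in> box_span c {1}" and B: "\<And>b. b \<in> B \<Longrightarrow> E * D b \<in> box_span c B"
    and f: "E ^ m * f \<in> box_span d B"
  shows "E ^ Suc m * D f \<in> box_span (d + c + 1) B"
proof -
  have Dg: "E * D g \<in> box_span (d + c + 1) B" if g: "g \<in> box_span d B" for g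
  proof (rule xt_span_image[OF _ _ _ g, where L = "\<lambda>g. E * D g"])
    fix h :: "'a fls fps" assume "h \<in> box_gens d B"
    then obtain i j b where h: "h = mono_tx i j * b" "i \<le> d" "\<bar>j\<bar> \<le> int d" and b: "b \<in> B"
      by (auto elim!: box_gensE)
    have m: "mono_tx i j \<in> box_span d {1 :: 'a fls fps}"
      using h by (intro mono_tx_in_box_span_1)
    have "E * D h = mono_tx i j * (E * D b) + E * (D (mono_tx i j) * b)"
      by (simp add: h mult algebra_simps)
    moreover have "mono_tx i j * (E * D b) \<in> box_span (d + c) B"
      by (rule box_span_mult[OF m B[OF b]])
    moreover have "E * (D (mono_tx i j) * b) \<in> box_span (c + (d + 1 + 0)) B"
      by (intro box_span_mult E poly[OF m] box_span_base b)
    ultimately show "E * D h \<in> box_span (d + c + 1) B"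
      by (auto intro!: xt.span_add elim: box_span_mono[rotated])
  qed (auto simp: add scl algebra_simps scl_mult_right)
  have "D 1 + D 1 = D 1 + 0" using mult[of 1 1] by simp
  then have D1: "D 1 = 0" by (simp only: add_left_cancel)
  \<comment> \<open>The factor \<open>E\<close> in front avoids the exponent \<open>n - 1\<close>.\<close>
  have DE: "E * D (E ^ n) = scl (of_nat n) (E ^ n * D E)" for n
  proof (induction n)
    case (Suc n)
    have "E * D (E ^ Suc n) = E * (E * D (E ^ n)) + E ^ Suc n * D E"
      by (simp add: mult algebra_simps)
    also have "\<dots> = scl (of_nat (Suc n)) (E ^ Suc n * D E)"
      by (simp add: Suc xt.scale_left_distrib scl_mult_right mult.assoc)
    finally show ?case .
  qed (simp add: D1)
  have "E * D (E ^ m * f) = E ^ Suc m * D f + scl (of_nat m) (D E * (E ^ m * f))"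
  proof -
    have "E * D (E ^ m * f) = E ^ Suc m * D f + E * D (E ^ m) * f"
      by (simp add: mult algebra_simps)
    moreover have "E * D (E ^ m) * f = scl (of_nat m) (D E * (E ^ m * f))"
      unfolding DE scl_mult_left by (simp only: mult_ac)
    ultimately show ?thesis by simp
  qed
  then have "E ^ Suc m * D f = E * D (E ^ m * f) - scl (of_nat m) (D E * (E ^ m * f))"
    by simp
  moreover have "D E * (E ^ m * f) \<in> box_span (c + 1 + d) B"
    by (intro box_span_mult poly E f)
  ultimately show ?thesis
    using Dg[OF f] by (auto intro!: xt.span_diff xt.span_scale simp: add_ac)
qed

text \<open>
  Creative telescoping by counting dimensions.  The hypotheses say that \<open>F\<close> lies in a module with
  finitely many generators \<open>B\<close> over the rational functions which is closed under \<open>\<partial>\<^sub>t\<close> and \<open>\<partial>\<^sub>x\<close>, where \<open>E\<close>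
  is a common denominator.
\<close>

theorem D_finite_residue:
  fixes F E :: "'a::field_char_0 fls fps"
  assumes "finite B" "E \<noteq> 0" and E: "E \<in> box_span c {1}" and F: "E * F \<in> box_span c B"
    and tB: "\<And>b. b \<in> B \<Longrightarrow> E * fps_deriv b \<in> box_span c B"
    and xB: "\<And>b. b \<in> B \<Longrightarrow> E * xderiv b \<in> box_span c B"
  shows "D_finite (xcoeff (-1) F)"
proof -
  \<comment> \<open>A filtration: multiplying by \<open>t\<close>, \<open>\<partial>\<^sub>t\<close> and \<open>\<partial>\<^sub>x\<close> raise the index by one each.  One step adds at most
    \<open>c + 1\<close> to the degree.\<close>
  define V where "V = (\<lambda>m. {f. E ^ m * f \<in> box_span (m * (c + 1)) B})"
  have mono1: "f \<in> V (Suc m)" if "f \<in> V m" for f m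
  proof -
    have "E * (E ^ m * f) \<in> box_span (c + m * (c + 1)) B"
      using that by (intro box_span_mult E) (simp add: V_def)
    then show ?thesis by (auto simp: V_def mult_ac elim: box_span_mono[rotated])
  qed
  have mono: "f \<in> V n" if "f \<in> V m" "m \<le> n" for f m n
    using that(2,1) by (induction n rule: dec_induct) (auto intro: mono1)
  have Vt: "fps_X * f \<in> V (Suc m)" if "f \<in> V m" for f m
  proof -
    have "mono_tx 1 0 * (E * (E ^ m * f)) \<in> box_span (1 + (c + m * (c + 1))) B"
      using that by (intro box_span_mult E mono_tx_in_box_span_1) (auto simp: V_def)
    then show ?thesis by (simp add: V_def mono_tx_def mult_ac add_ac)
  qed
  have Vdt: "fps_deriv f \<in> V (Suc m)" if "f \<in> V m" for f m
    using box_span_derivation[of fps_deriv E c B m f "m * (c + 1)"] that E tB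
    by (simp add: V_def fps_deriv_scl fps_deriv_box_span_1[simplified] add_ac)
  have Vdx: "xderiv f \<in> V (Suc m)" if "f \<in> V m" for f m
    using box_span_derivation[of xderiv E c B m f "m * (c + 1)"] that E xB
    by (simp add: V_def xderiv_scl xderiv_add xderiv_mult xderiv_box_span_1[simplified] add_ac)
  have F1: "F \<in> V 1" using F by (auto simp: V_def elim: box_span_mono[rotated])
  define op where "op = (\<lambda>(i, j, k). fps_X ^ i * (xderiv ^^ k) ((fps_deriv ^^ j) F))"
  have op_V: "op (i, j, k) \<in> V (1 + j + k + i)" for i j k
  proof -
    have "(fps_deriv ^^ j) F \<in> V (1 + j)" by (induction j) (use F1 Vdt in auto)
    then have "(xderiv ^^ k) ((fps_deriv ^^ j) F) \<in> V (1 + j + k)"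
      by (induction k) (use Vdx in auto)
    then show ?thesis by (induction i) (use Vt in \<open>auto simp: op_def mult.assoc\<close>)
  qed
  \<comment> \<open>All vectors \<open>op i\<close> with entries of \<open>i\<close> below \<open>N\<close> lie in \<open>V (3 * N)\<close>, whose dimension is at most the cardinality
    of \<open>G\<close>; the factor \<open>54\<close> is \<open>(2 * 3) * (3 * 3)\<close> from the estimate below, and makes \<open>N\<^sup>3\<close> exceed it.\<close>
  define N where "N = 54 * (c + 1) ^ 2 * card B + 1"
  define M where "M = 3 * N"
  define G where "G = box_gens (M * (c + 1)) B"
  define I where "I = {..<N} \<times> {..<N} \<times> {..<N}"
  have "card G \<le> Suc (M * (c + 1)) * (2 * (M * (c + 1)) + 1) * card B"
    unfolding G_def using assms(1) by (rule card_box_gens_le)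
  also have "\<dots> \<le> (2 * (M * (c + 1))) * (3 * (M * (c + 1))) * card B"
    by (intro mult_right_mono mult_mono) (auto simp: M_def N_def)
  also have "\<dots> = N ^ 2 * (54 * (c + 1) ^ 2 * card B)"
    by (simp add: M_def power2_eq_square algebra_simps)
  finally have "card G \<le> N ^ 2 * (54 * (c + 1) ^ 2 * card B)" .
  also have "\<dots> < N ^ 2 * N" by (intro mult_strict_left_mono) (auto simp: N_def)
  also have "\<dots> = card I" by (simp add: I_def card_cartesian_product power2_eq_square)
  finally have "card G < card I" .
  moreover have "E ^ M * op i \<in> xt.span G" if "i \<in> I" for i
  proof -
    obtain x y z where i: "i = (x, y, z)" by (cases i)
    with that have "x < N" "y < N" "z < N" by (auto simp: I_def)
    then have "op i \<in> V M" using mono[OF op_V[of x y z], of M] by (simp add: M_def i)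
    then show ?thesis by (simp add: V_def G_def)
  qed
  moreover have "finite I" "finite G"
    using assms(1) by (simp_all add: I_def G_def finite_box_gens)
  ultimately obtain u where u: "\<exists>i\<in>I. u i \<noteq> 0" "(\<Sum>i\<in>I. scl (u i) (E ^ M * op i)) = 0"
    using xt.ex_nontrivial_relation[of I G "\<lambda>i. E ^ M * op i"] by blast
  have "E ^ M * (\<Sum>i\<in>I. scl (u i) (op i)) = 0"
    using u(2) by (simp add: sum_distrib_left scl_mult_right)
  then have rel: "(\<Sum>i\<in>I. scl (u i) (op i)) = 0" using \<open>E \<noteq> 0\<close> by simp
  \<comment> \<open>The least order \<open>k\<close> of \<open>\<partial>\<^sub>x\<close> in the relation.\<close>
  define P where "P = (\<lambda>k. \<exists>i<N. \<exists>j<N. k < N \<and> u (i, j, k) \<noteq> 0)"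
  define k where "k = (LEAST k. P k)"
  have "\<exists>k. P k" using u(1) by (fastforce simp: P_def I_def)
  then have k: "P k" unfolding k_def by (rule LeastI_ex)
  then have "k < N" by (auto simp: P_def)
  have min: "u (i, j, l) = 0" if "i < N" "j < N" "l < k" for i j l
    using not_less_Least[of l P, folded k_def] that \<open>k < N\<close> by (auto simp: P_def)
  define h where "h = (\<lambda>i j. fps_X ^ i * fps_nth_deriv j (xcoeff (-1) F))"
  \<comment> \<open>Taking the residue against \<open>x\<^sup>k\<close>: orders above \<open>k\<close> vanish by \<open>xcoeff_xderiv_funpow\<close>, those below \<open>k\<close> by
    the choice of \<open>k\<close>.\<close>
  have coeff_op: "xcoeff (-1 - int k) (scl (u (i, j, l)) (op (i, j, l))) =
      (if l = k then fps_const (pochhammer (- of_nat k) k * u (i, j, k)) * h i j else 0)"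
    if "i < N" "j < N" for i j l
  proof -
    have "xcoeff (-1 - int k) (op (i, j, l)) = fps_const (pochhammer (- of_nat k) l) *
        (fps_X ^ i * fps_nth_deriv j (xcoeff (int l - 1 - int k) F))"
      unfolding op_def prod.case xcoeff_X_power xcoeff_xderiv_funpow xcoeff_deriv_funpow
      by (simp only: mult_ac)
    moreover have "pochhammer (- of_nat k) l = (0 :: 'a)" if "l > k"
      using that by (simp add: pochhammer_of_nat_eq_0_iff)
    ultimately show ?thesis
      using min[OF that, of l] by (cases l k rule: linorder_cases)
        (auto simp: xcoeff_scl h_def mult_ac fps_const_mult[symmetric] simp del: fps_const_mult)
  qed
  have "0 = xcoeff (-1 - int k) (\<Sum>i\<in>I. scl (u i) (op i))" by (simp add: rel)
  also have "\<dots> = (\<Sum>i<N. \<Sum>j<N. \<Sum>l<N. xcoeff (-1 - int k) (scl (u (i, j, l)) (op (i, j, l))))"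
    by (simp add: I_def xcoeff_sum sum.cartesian_product)
  also have "\<dots> = (\<Sum>i<N. \<Sum>j<N. \<Sum>l<N.
      if l = k then fps_const (pochhammer (- of_nat k) k * u (i, j, k)) * h i j else 0)"
    by (intro sum.cong refl coeff_op) auto
  also have "\<dots> = (\<Sum>i<N. \<Sum>j<N. fps_const (pochhammer (- of_nat k) k * u (i, j, k)) * h i j)"
    using \<open>k < N\<close> by simp
  also have "\<dots> = fps_const (pochhammer (- of_nat k) k) *
      (\<Sum>i<N. \<Sum>j<N. fps_const (u (i, j, k)) * h i j)"
    by (simp add: sum_distrib_left mult.assoc fps_const_mult[symmetric] del: fps_const_mult)
  finally have rel_t: "(\<Sum>i<N. \<Sum>j<N. fps_const (u (i, j, k)) * h i j) = 0"
    by (auto simp: pochhammer_of_nat_eq_0_iff)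
  define p where "p = (\<lambda>j. \<Sum>i<N. monom (u (i, j, k)) i)"
  have coeff_p: "coeff (p j) i = u (i, j, k)" if "i < N" for i j
    using that by (simp add: p_def coeff_sum)
  have fps_p: "fps_of_poly (p j) = (\<Sum>i<N. fps_const (u (i, j, k)) * fps_X ^ i)" for j
    by (simp add: p_def fps_of_poly_sum fps_of_poly_monom)
  have "(\<Sum>j\<le>N - 1. fps_of_poly (p j) * fps_nth_deriv j (xcoeff (-1) F)) =
      (\<Sum>j<N. \<Sum>i<N. fps_const (u (i, j, k)) * h i j)"
    unfolding fps_p h_def sum_distrib_right mult.assoc
    by (intro sum.cong) (auto simp: N_def)
  also have "\<dots> = 0" by (subst sum.swap) (rule rel_t)
  finally have eq: "(\<Sum>j\<le>N - 1. fps_of_poly (p j) * fps_nth_deriv j (xcoeff (-1) F)) = 0" .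
  obtain i j where ij: "i < N" "j < N" "u (i, j, k) \<noteq> 0" using k by (auto simp: P_def)
  then have "p j \<noteq> 0" using coeff_p[of i j] by auto
  moreover have "j \<le> N - 1" using ij by simp
  ultimately show ?thesis using eq unfolding D_finite_def by blast
qed

definition laurent_poly :: "'a::field fls fps \<Rightarrow> bool" where
  "laurent_poly f \<longleftrightarrow> (\<exists>d. f \<in> box_span d {1})"

lemma laurent_poly_add: "laurent_poly f \<Longrightarrow> laurent_poly g \<Longrightarrow> laurent_poly (f + g)"
  unfolding laurent_poly_def
  by (metis box_span_mono max.cobounded1 max.cobounded2 xt.span_add)

lemma laurent_poly_mult: "laurent_poly f \<Longrightarrow> laurent_poly g \<Longrightarrow> laurent_poly (f * g)"
  unfolding laurent_poly_def using box_span_mult by blast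

lemma laurent_poly_scalar: "laurent_poly (fps_const (fls_const c))"
  using xt.span_scale[OF box_span_base[of 1 "{1}"], of c]
  unfolding laurent_poly_def scl_def by auto

lemma laurent_poly_1: "laurent_poly 1"
  using laurent_poly_scalar[of 1] by simp

lemma laurent_poly_numeral: "laurent_poly (numeral k)"
  using laurent_poly_scalar[of "numeral k"] by (simp add: numeral_fps_const fls_const_numeral)

lemma laurent_poly_uminus: "laurent_poly f \<Longrightarrow> laurent_poly (- f)"
  unfolding laurent_poly_def by (metis xt.span_neg)

lemma laurent_poly_diff: "laurent_poly f \<Longrightarrow> laurent_poly g \<Longrightarrow> laurent_poly (f - g)"
  unfolding diff_conv_add_uminus by (intro laurent_poly_add laurent_poly_uminus)

lemma laurent_poly_power: "laurent_poly f \<Longrightarrow> laurent_poly (f ^ n)"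
  by (induction n) (auto intro: laurent_poly_1 laurent_poly_mult)

lemma laurent_poly_mono_tx: "laurent_poly (mono_tx i j)"
  unfolding laurent_poly_def
  using mono_tx_in_box_span_1[of i "i + nat \<bar>j\<bar>" j] by auto

lemma laurent_poly_X: "laurent_poly fps_X"
  using laurent_poly_mono_tx[of 1 0] by (simp add: mono_tx_def)

lemma laurent_poly_const_X_intpow: "laurent_poly (fps_const (fls_X_intpow j))"
  using laurent_poly_mono_tx[of 0 j] by (simp add: mono_tx_def)

lemma laurent_poly_step_poly: "laurent_poly (fps_const (step_poly S j))"
proof -
  have "laurent_poly (fps_const (\<Sum>i\<in>I. fls_X_intpow i))" for I
  proof (induction I rule: infinite_finite_induct)
    case (insert x F)
    then show ?case
      by (simp add: fps_const_add[symmetric] laurent_poly_add laurent_poly_const_X_intpow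
          del: fps_const_add)
  qed (use laurent_poly_scalar[of 0] in auto)
  then show ?thesis unfolding step_poly_def .
qed

lemma laurent_poly_fps_deriv: "laurent_poly f \<Longrightarrow> laurent_poly (fps_deriv f)"
  unfolding laurent_poly_def using fps_deriv_box_span_1 by blast

lemma laurent_poly_xderiv: "laurent_poly f \<Longrightarrow> laurent_poly (xderiv f)"
  unfolding laurent_poly_def using xderiv_box_span_1 by blast

lemmas laurent_poly_intros = laurent_poly_add laurent_poly_mult laurent_poly_scalar laurent_poly_1
  laurent_poly_numeral laurent_poly_diff laurent_poly_uminus laurent_poly_power laurent_poly_X
  laurent_poly_const_X_intpow laurent_poly_step_poly laurent_poly_fps_deriv laurent_poly_xderiv

text \<open>
  The module spanned by \<open>1\<close> and \<open>s\<close> is closed under both derivations, because \<open>s\<^sup>2 = \<Delta>\<close> gives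
  \<open>\<Delta> \<partial>s = (\<partial>\<Delta> / 2) s\<close>.  So \<open>\<Delta> D\<close> serves as the common denominator.
\<close>

lemma D_finite_residue_sqrt:
  fixes F s \<Delta> D p q :: "'a::field_char_0 fls fps"
  assumes sq: "s ^ 2 = \<Delta>" and F: "D * F = p + q * s" and nz: "\<Delta> \<noteq> 0" "D \<noteq> 0"
    and lp: "laurent_poly \<Delta>" "laurent_poly D" "laurent_poly p" "laurent_poly q"
  shows "D_finite (xcoeff (-1) F)"
proof -
  define half :: "'a fls fps" where "half = fps_const (fls_const (1 / 2))"
  have "half * 2 = 1"
  proof -
    have "half * 2 = fps_const (fls_const (1 / 2 * 2))"
      by (simp only: half_def numeral_fps_const fls_const_numeral[symmetric] fps_const_mult
          fls_const_mult_const)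
    then show ?thesis by simp
  qed
  then have half: "half * (2 * f) = f" for f by (simp add: mult.assoc[symmetric])
  have ds: "\<Delta> * d s = half * d \<Delta> * s"
    if "\<And>f g :: 'a fls fps. d (f * g) = f * d g + d f * g" for d
  proof -
    have "d \<Delta> = 2 * (s * d s)"
      by (simp add: sq[symmetric] power2_eq_square that mult.commute)
    then have "half * d \<Delta> = s * d s" by (simp add: half)
    then have "half * d \<Delta> * s = s ^ 2 * d s" by (simp add: power2_eq_square mult_ac)
    then show ?thesis by (simp add: sq)
  qed
  define E where "E = \<Delta> * D"
  define B where "B = {1, s}"
  note intros = laurent_poly_intros[where 'a = 'a]
  have "laurent_poly E" unfolding E_def by (intro intros lp)
  then obtain d1 where d1: "E \<in> box_span d1 {1}" by (auto simp: laurent_poly_def)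
  have "laurent_poly (\<Delta> * p)" "laurent_poly (\<Delta> * q)" by (intro intros lp)+
  then obtain d2 d3 where d2: "\<Delta> * p \<in> box_span d2 {1}" and d3: "\<Delta> * q \<in> box_span d3 {1}"
    by (auto simp: laurent_poly_def)
  have "laurent_poly (D * (half * fps_deriv \<Delta>))" "laurent_poly (D * (half * xderiv \<Delta>))"
    unfolding half_def by (intro intros lp)+
  then obtain d4 d5 where d4: "D * (half * fps_deriv \<Delta>) \<in> box_span d4 {1}"
      and d5: "D * (half * xderiv \<Delta>) \<in> box_span d5 {1}"
    by (auto simp: laurent_poly_def)
  define c where "c = Max {d1, d2, d3, d4, d5}"
  have le: "d1 \<le> c" "d2 \<le> c" "d3 \<le> c" "d4 \<le> c" "d5 \<le> c" by (auto simp: c_def)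
  have mem: "f * b \<in> box_span c B" if "f \<in> box_span d {1}" "d \<le> c" "b \<in> B" for f d b
    using box_span_mult[OF box_span_mono[OF that(2,1)] box_span_base[OF that(3)]] by simp
  have B: "1 \<in> B" "s \<in> B" by (auto simp: B_def)
  show ?thesis
  proof (rule D_finite_residue[of B E c])
    show "finite B" "E \<noteq> 0" using nz by (auto simp: B_def E_def)
    show "E \<in> box_span c {1}" using box_span_mono[OF le(1) d1] .
    have "E * F = \<Delta> * (D * F)" by (simp add: E_def mult.assoc)
    then have "E * F = \<Delta> * p * 1 + \<Delta> * q * s" by (simp add: F algebra_simps)
    then show "E * F \<in> box_span c B"
      using mem[OF d2 le(2) B(1)] mem[OF d3 le(3) B(2)] by (simp add: xt.span_add)
  next
    fix b assume "b \<in> B"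
    then consider "b = 1" | "b = s" by (auto simp: B_def)
    then show "E * fps_deriv b \<in> box_span c B"
    proof cases
      case 2
      have "E * fps_deriv s = D * (\<Delta> * fps_deriv s)" by (simp add: E_def mult_ac)
      also have "\<dots> = D * (half * fps_deriv \<Delta>) * s" by (subst ds) (auto simp: mult.assoc)
      finally show ?thesis using mem[OF d4 le(4) B(2)] 2 by simp
    qed (simp add: xt.span_zero)
  next
    fix b assume "b \<in> B"
    then consider "b = 1" | "b = s" by (auto simp: B_def)
    then show "E * xderiv b \<in> box_span c B"
    proof cases
      case 1
      have "xderiv 1 = (0 :: 'a fls fps)" by (auto simp: fps_eq_iff fps_one_nth)
      then show ?thesis using 1 by (simp add: xt.span_zero)
    next
      case 2
      have "E * xderiv s = D * (\<Delta> * xderiv s)" by (simp add: E_def mult_ac)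
      also have "\<dots> = D * (half * xderiv \<Delta>) * s"
        by (subst ds) (auto simp: mult.assoc xderiv_mult)
      finally show ?thesis using mem[OF d5 le(5) B(2)] 2 by simp
    qed
  qed
qed

section \<open>D-finiteness for symmetric step sets\<close>

text \<open>
  The hypothesis \<open>a \<noteq> 1\<close> makes the denominator \<open>D\<close> of \<open>H\<close> non-zero: its constant coefficient in \<open>t\<close> is
  \<open>4 (1 - a)\<close>.
\<close>

theorem D_finite_walk_gf_symmetric:
  fixes a :: "'a::field_char_0"
  assumes S: "S \<subseteq> {-1, 0, 1} \<times> {-1, 0, 1}" and sym: "\<And>i j. (i, j) \<in> S \<Longrightarrow> (- i, j) \<in> S"
    and "a \<noteq> 1"
  shows "D_finite (walk_gf S a 1)"
proof -
  define t :: "'a fls fps" where "t = fps_X"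
  define \<alpha> :: "'a fls fps" where "\<alpha> = fps_const (fls_const a)"
  define U V W :: "'a fls fps" where "U = fps_const (step_poly S 1)"
    and "V = fps_const (step_poly S 0)" and "W = fps_const (step_poly S (-1))"
  obtain r where r: "r = t * (U + V * r + W * r ^ 2)"
    using ex_quadratic_root unfolding t_def U_def V_def W_def by blast
  define H where "H = inverse (1 - t * (\<alpha> * (V + W * r)))"
  have "H * (1 - t * (\<alpha> * (V + W * r))) = 1"
    unfolding H_def by (rule inverse_mult_eq_1) (simp add: t_def)
  then have H: "H = 1 + t * (\<alpha> * (V * H + W * (H * r)))" by (simp add: algebra_simps)
  have H_nth: "H $ n = half_plane S a n 0" for n
    using half_plane_gf[OF r[unfolded t_def U_def V_def W_def]
        H[unfolded t_def \<alpha>_def V_def W_def], of 0 n] by simp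
  define g :: "'a fls fps" where "g = fps_const (fls_X_intpow (-1)) - fps_const (fls_X_intpow 1)"
  have fin: "finite S" using S by (rule finite_subset) auto
  have "walk_gf S a 1 $ n = xcoeff (-1) (g * H) $ n" for n
  proof -
    have "(g * H) $ n = fls_X_intpow (-1) * H $ n - fls_X_intpow 1 * H $ n"
      by (simp add: g_def left_diff_distrib del: fls_X_conv_shift_1)
    moreover have "(fls_X_intpow i * f) $$ j = f $$ (j - i)" for i j and f :: "'a fls"
      by (simp add: fls_X_intpow_times_conv_shift)
    ultimately have "xcoeff (-1) (g * H) $ n = H $ n $$ 0 - H $ n $$ (-2)"
      by (simp only: xcoeff_nth fls_minus_nth) simp
    then show ?thesis
      using reflection_principle[OF S sym, of 0 a n 0]
      by (simp add: walk_gf_eq_weighted_walks[OF fin] H_nth)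
  qed
  then have gf: "walk_gf S a 1 = xcoeff (-1) (g * H)" by (simp add: fps_eq_iff)
  \<comment> \<open>Completing the square in the quadratic equation of \<open>r\<close>: the square of \<open>s\<close> is free of \<open>r\<close>, and \<open>H\<close> depends on
    \<open>r\<close> through \<open>s\<close> only.\<close>
  define s where "s = 1 - t * V - 2 * t * W * r"
  define \<Delta> where "\<Delta> = (1 - t * V) ^ 2 - 4 * t ^ 2 * U * W"
  have sq: "s ^ 2 = \<Delta>"
  proof -
    have "s ^ 2 = (1 - t * V) ^ 2 - 4 * t * W * (r - t * V * r - t * W * r ^ 2)"
      by (simp add: s_def power2_eq_square algebra_simps)
    also have "r - t * V * r - t * W * r ^ 2 = t * U"
      by (subst (1) r) (simp add: algebra_simps)
    finally show ?thesis by (simp add: \<Delta>_def power2_eq_square algebra_simps)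
  qed
  define N where "N = 2 - \<alpha> - t * \<alpha> * V"
  define D where "D = N ^ 2 - \<alpha> ^ 2 * \<Delta>"
  have "H * (N + \<alpha> * s) = 2 * (H - t * (\<alpha> * (V * H + W * (H * r))))"
    by (simp add: N_def s_def algebra_simps)
  also have "H - t * (\<alpha> * (V * H + W * (H * r))) = 1"
    by (subst (1) H) simp
  finally have HN: "H * (N + \<alpha> * s) = 2" by simp
  \<comment> \<open>Rationalising the denominator of \<open>H = 2 / (N + \<alpha> s)\<close>.\<close>
  have "D = (N + \<alpha> * s) * (N - \<alpha> * s)"
    by (simp add: D_def sq[symmetric] power2_eq_square algebra_simps)
  then have "D * (g * H) = (H * (N + \<alpha> * s)) * (g * (N - \<alpha> * s))" by (simp add: mult_ac)
  then have DF: "D * (g * H) = 2 * g * N + (- 2 * g * \<alpha>) * s"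
    unfolding HN by (simp add: algebra_simps)
  have \<Delta>0: "\<Delta> $ 0 = 1" by (simp add: \<Delta>_def t_def power2_eq_square)
  have a1: "fls_const a \<noteq> 1" using \<open>a \<noteq> 1\<close> by (auto simp: fls_eq_iff dest: spec[of _ 0])
  have "D $ 0 = (2 - fls_const a) ^ 2 - fls_const a ^ 2"
    by (simp add: D_def N_def t_def \<alpha>_def \<Delta>0 power2_eq_square)
  also have "\<dots> = 4 * (1 - fls_const a)" by (simp add: power2_eq_square algebra_simps)
  also have "\<dots> \<noteq> 0" using a1 by simp
  finally have D0: "D \<noteq> 0" by auto
  note intros = laurent_poly_intros[where 'a = 'a]
  show ?thesis unfolding gf
  proof (rule D_finite_residue_sqrt[OF sq DF _ D0])
    show "\<Delta> \<noteq> 0" using \<Delta>0 by auto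
    show "laurent_poly \<Delta>" "laurent_poly D" "laurent_poly (2 * g * N)" "laurent_poly (- 2 * g * \<alpha>)"
      unfolding \<Delta>_def D_def N_def g_def t_def U_def V_def W_def \<alpha>_def by (intro intros)+
  qed
qed

lemma indet_a_neq_1: "indet_a \<noteq> 1"
  by (simp add: indet_a_def One_fract_def eq_fract one_pCons)

theorem theorem2:
  fixes S T :: "(int \<times> int) set"
  assumes "T \<in> {{(1, 1), (-1, 1), (0, -1)},
                {(0, 1), (1, 1), (-1, 1), (0, -1)},
                {(0, 1), (1, 1), (-1, 1), (1, -1), (-1, -1)},
                {(0, 1), (0, -1), (1, -1), (-1, -1)},
                {(1, 1), (-1, 1), (0, -1), (1, -1), (-1, -1)},
                {(0, 1), (1, -1), (-1, -1)}}"
    and "S = T \<or> S = T \<union> {(1, 0), (-1, 0)}"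
  shows "D_finite (walk_gf S indet_a 1)"
proof (rule D_finite_walk_gf_symmetric)
  show "S \<subseteq> {-1, 0, 1} \<times> {-1, 0, 1}" using assms by (elim insertE disjE) auto
  show "(- i, j) \<in> S" if "(i, j) \<in> S" for i j using assms that by (elim insertE disjE) auto
qed (rule indet_a_neq_1)

end
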